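(* Let $\beta:=\sqrt{7+2\sqrt2}$, $\alpha:=1+\sqrt2+\beta$, $\gamma:=\sqrt{16+\alpha^2}$. The limits $$p_\bot:=\lim_{n\to\infty}\frac{f_n}{g_n},\qquad p_a:=\lim_{n\to\infty}\frac{a_n}{g_n},\qquad p_b:=\lim_{n\to\infty}\frac{b_n}{g_n},\qquad p_\top:=\lim_{n\to\infty}\frac{t_n}{g_n}$$ exist and satisfy $p_\bot+p_a+p_b+p_\top=1$. Moreover, $$p_\bot=\frac12-\frac{\sqrt2}{4},\qquad p_a=\frac{2+\sqrt2}{2\alpha\beta},\qquad p_b=\frac{(2+\sqrt2)\,\alpha}{\beta\,\gamma\,(\alpha+\gamma)},\qquad p_\top=\frac{(2+\sqrt2)\,\alpha\,(\alpha+\gamma)}{16\,\beta\,\gamma}.$$ In particular $p_\top\approx 0.684122210733017786\ldots$.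
   Context: Let $V_4=\{0<a<b<1\}$ be a four-element chain with Gödel implication $x\Rightarrow_G y=1$ if $x\le y$ and $x\Rightarrow_G y=y$ if $x>y$. For $n\ge1$, consider the $C_{n-1}$ full bracketings of $p_1\Rightarrow_G p_2\Rightarrow_G\cdots\Rightarrow_G p_n$ in $n$ distinct variables (equivalently, full binary trees with $n$ ordered leaves $p_1,\dots,p_n$), where $C_k=\frac{1}{k+1}\binom{2k}{k}$ is the Catalan number. Let $f_n,a_n,b_n,t_n$ be the number of pairs (bracketing, valuation $\{p_1,\dots,p_n\}\to V_4$) for which the bracketed formula evaluates to $0,a,b,1$ respectively, and let $g_n=f_n+a_n+b_n+t_n=4^nC_{n-1}$. *)

theory Defs
  imports "HOL-Analysis.Analysis"
begin

datatype V4 = V0 | Va | Vb | V1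

fun rank_V4 :: "V4 \<Rightarrow> nat" where
  "rank_V4 V0 = 0"
| "rank_V4 Va = 1"
| "rank_V4 Vb = 2"
| "rank_V4 V1 = 3"

instantiation V4 :: "{linorder, order_top}"
begin

definition less_eq_V4 :: "V4 \<Rightarrow> V4 \<Rightarrow> bool" where
  "x \<le> y \<longleftrightarrow> rank_V4 x \<le> rank_V4 y"

definition less_V4 :: "V4 \<Rightarrow> V4 \<Rightarrow> bool" where
  "x < y \<longleftrightarrow> rank_V4 x < rank_V4 y"

definition top_V4 :: V4 where
  "top = V1"

instance
proof
  fix x y :: V4
  show "x \<le> y \<Longrightarrow> y \<le> x \<Longrightarrow> x = y"
    by (cases x; cases y) (simp_all add: less_eq_V4_def)
  show "x \<le> top"
    by (cases x) (simp_all add: less_eq_V4_def top_V4_def)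
qed (auto simp: less_eq_V4_def less_V4_def)

end

instance V4 :: finite
proof
  have "(UNIV :: V4 set) = {V0, Va, Vb, V1}"
    using V4.exhaust by blast
  then show "finite (UNIV :: V4 set)"
    by (metis finite.emptyI finite.insertI)
qed

definition goedel_imp :: "'a::{linorder, order_top} \<Rightarrow> 'a \<Rightarrow> 'a" where
  "goedel_imp x y = (if x \<le> y then top else y)"

datatype formula = Var nat | Imp formula formula

fun leaves :: "formula \<Rightarrow> nat list" where
  "leaves (Var i) = [i]"
| "leaves (Imp s t) = leaves s @ leaves t"

fun eval_formula :: "(nat \<Rightarrow> 'a::{linorder, order_top}) \<Rightarrow> formula \<Rightarrow> 'a" where
  "eval_formula v (Var i) = v i"
| "eval_formula v (Imp s t) = goedel_imp (eval_formula v s) (eval_formula v t)"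

definition bracketings :: "nat \<Rightarrow> formula set" where
  "bracketings n = {\<phi>. leaves \<phi> = [1..<Suc n]}"

text \<open>Valuations are extensional functions (constant \<open>undefined\<close> outside \<open>{1..n}\<close>), so each map
  from the \<open>n\<close> variables to \<open>V4\<close> is counted exactly once.\<close>

definition valuations :: "nat \<Rightarrow> (nat \<Rightarrow> V4) set" where
  "valuations n = {1..n} \<rightarrow>\<^sub>E UNIV"

definition value_count :: "V4 \<Rightarrow> nat \<Rightarrow> nat" where
  "value_count c n =
     card {(\<phi>, v). \<phi> \<in> bracketings n \<and> v \<in> valuations n \<and> eval_formula v \<phi> = c}"

definition f_count :: "nat \<Rightarrow> nat" where "f_count = value_count V0"
definition a_count :: "nat \<Rightarrow> nat" where "a_count = value_count Va"
definition b_count :: "nat \<Rightarrow> nat" where "b_count = value_count Vb"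
definition t_count :: "nat \<Rightarrow> nat" where "t_count = value_count V1"

definition g_count :: "nat \<Rightarrow> nat" where
  "g_count n = f_count n + a_count n + b_count n + t_count n"

text \<open>Finiteness, so that the cardinality in the definition of \<open>value_count\<close> is never the default value for
  infinite sets.\<close>

lemma finite_valuations: "finite (valuations n)"
  unfolding valuations_def by (intro finite_PiE) auto

lemma leaves_nonempty: "leaves \<phi> \<noteq> []"
  by (induction \<phi>) auto

lemma finite_leaves_eq: "finite {\<phi>. leaves \<phi> = xs}"
proof (induction "length xs" arbitrary: xs rule: less_induct)
  case less
  let ?P = "\<lambda>i. (\<lambda>(s, t). Imp s t) `
    ({\<phi>. leaves \<phi> = take i xs} \<times> {\<phi>. leaves \<phi> = drop i xs})"
  have "{\<phi>. leaves \<phi> = xs} \<subseteq> insert (Var (hd xs)) (\<Union>i\<in>{0<..<length xs}. ?P i)"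
  proof
    fix \<phi> assume "\<phi> \<in> {\<phi>. leaves \<phi> = xs}"
    then have xs: "leaves \<phi> = xs" by simp
    show "\<phi> \<in> insert (Var (hd xs)) (\<Union>i\<in>{0<..<length xs}. ?P i)"
    proof (cases \<phi>)
      case (Var i)
      with xs show ?thesis by auto
    next
      case (Imp s t)
      with xs have "leaves s @ leaves t = xs" by simp
      then have "\<phi> \<in> ?P (length (leaves s))" "length (leaves s) \<in> {0<..<length xs}"
        using Imp leaves_nonempty[of s] leaves_nonempty[of t] by auto
      then show ?thesis by blast
    qed
  qed
  moreover have "finite (\<Union>i\<in>{0<..<length xs}. ?P i)"
    by (intro finite_UN_I finite_imageI finite_cartesian_product less) auto
  ultimately show ?case by (meson finite_insert finite_subset)
qed

lemma finite_bracketings: "finite (bracketings n)"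
  unfolding bracketings_def by (rule finite_leaves_eq)

lemma finite_value_count_set:
  "finite {(\<phi>, v). \<phi> \<in> bracketings n \<and> v \<in> valuations n \<and> eval_formula v \<phi> = c}"
  by (rule finite_subset[OF _ finite_cartesian_product[OF finite_bracketings finite_valuations]]) auto

end

theory Submission
  imports Defs
begin

text \<open>
  Put \<open>w n = g n / 16 ^ n\<close>. Its sum is \<open>1 / 2\<close>, its consecutive ratios tend to 1, and its
  self-convolution is \<open>w n\<close> itself for \<open>n \<ge> 2\<close>; so \<open>w\<close> is subexponential: a convolution of two
  sequences dominated by \<open>w\<close> and asymptotic to \<open>\<nu> w\<close> and \<open>\<mu> w\<close> is asymptotic to
  \<open>(\<nu> V + \<mu> U) w\<close>, where \<open>U\<close> and \<open>V\<close> are their sums.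
  A formula has a non-top value \<open>c\<close> iff it is a leaf with value \<open>c\<close>, or its right part has value
  \<open>c\<close> and its left part a value above \<open>c\<close>. Hence \<open>f\<close>, \<open>a\<close>, \<open>b\<close>, divided by \<open>16 ^ n\<close>, are
  successive solutions of \<open>x = \<delta> / 16 + (h - x) * x\<close> with \<open>h = w\<close>, \<open>w - f\<close>, \<open>w - f - a\<close>,
  where \<open>\<delta>\<close> is the indicator of \<open>n = 1\<close> and \<open>*\<close> is convolution.
  If \<open>h\<close> is asymptotic to \<open>\<eta> w\<close>, then the limit of \<open>x n / w n\<close> must be a fixed point of
  \<open>\<nu> \<mapsto> (\<eta> - \<nu>) X + \<nu> (H - X)\<close>, with \<open>H\<close> and \<open>X\<close> the sums of \<open>h\<close> and \<open>x\<close>, and it exists because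
  the asymptotic error is contracted by the factor \<open>H \<le> 1 / 2\<close>.
\<close>

subsection \<open>Counting by leaf-labelled trees\<close>

text \<open>A bracketing with a valuation is encoded as one tree whose leaves carry truth values.
  With the variable numbers gone, both subtrees of a node are objects of the same kind, so cutting
  at the root needs no renumbering.\<close>

datatype 'a ltree = Leaf 'a | Node "'a ltree" "'a ltree"

fun labels :: "'a ltree \<Rightarrow> 'a list" where
  "labels (Leaf x) = [x]"
| "labels (Node s t) = labels s @ labels t"

fun ltree_value :: "'a::{linorder, order_top} ltree \<Rightarrow> 'a" where
  "ltree_value (Leaf x) = x"
| "ltree_value (Node s t) = goedel_imp (ltree_value s) (ltree_value t)"

fun label_formula :: "(nat \<Rightarrow> 'a) \<Rightarrow> formula \<Rightarrow> 'a ltree" where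
  "label_formula v (Var i) = Leaf (v i)"
| "label_formula v (Imp s t) = Node (label_formula v s) (label_formula v t)"

definition ltrees :: "V4 \<Rightarrow> nat \<Rightarrow> V4 ltree set" where
  "ltrees c n = {t. length (labels t) = n \<and> ltree_value t = c}"

lemma labels_nonempty: "labels t \<noteq> []"
  by (induction t) auto

lemma ltree_value_label_formula: "ltree_value (label_formula v \<phi>) = eval_formula v \<phi>"
  by (induction \<phi>) auto

lemma labels_label_formula: "labels (label_formula v \<phi>) = map v (leaves \<phi>)"
  by (induction \<phi>) auto

text \<open>Labelled trees keep their shape, so equal images have left parts with equally many
  leaves. The common leaf list is therefore cut at the same place on both sides, and the induction
  goes on in each part.\<close>

lemma label_formula_inject:
  "label_formula v \<phi> = label_formula v' \<psi> \<Longrightarrow> leaves \<phi> = leaves \<psi> \<Longrightarrow> \<phi> = \<psi>"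
proof (induction \<phi> arbitrary: \<psi>)
  case (Var i)
  then show ?case by (cases \<psi>) auto
next
  case (Imp s t)
  then obtain s' t' where \<psi>: "\<psi> = Imp s' t'" by (cases \<psi>) auto
  have eq: "label_formula v s = label_formula v' s'" "label_formula v t = label_formula v' t'"
    using Imp.prems \<psi> by auto
  have "length (leaves s) = length (leaves s')"
    using arg_cong[OF eq(1), of "\<lambda>t. length (labels t)"] by (simp add: labels_label_formula)
  then have "leaves s = leaves s'" "leaves t = leaves t'"
    using Imp.prems(2) \<psi> by auto
  then show ?case using Imp.IH eq \<psi> by auto
qed

text \<open>The free starting number \<open>m\<close> lets the right subtree be numbered from where
  the left one ends. The formula is fixed before \<open>v\<close>, so a valuation can afterwards be
  read off from the labels.\<close>

lemma ex_label_formula: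
  "\<exists>\<phi>. leaves \<phi> = [m..<m + length (labels t)] \<and>
     (\<forall>v. map v [m..<m + length (labels t)] = labels t \<longrightarrow> label_formula v \<phi> = t)"
proof (induction t arbitrary: m)
  case (Leaf x)
  show ?case by (rule exI[of _ "Var m"]) auto
next
  case (Node s t)
  let ?k = "length (labels s)" and ?l = "length (labels t)"
  obtain \<phi> where \<phi>: "leaves \<phi> = [m..<m + ?k]"
    "\<And>v. map v [m..<m + ?k] = labels s \<Longrightarrow> label_formula v \<phi> = s"
    using Node.IH(1) by blast
  obtain \<psi> where \<psi>: "leaves \<psi> = [m + ?k..<m + ?k + ?l]"
    "\<And>v. map v [m + ?k..<m + ?k + ?l] = labels t \<Longrightarrow> label_formula v \<psi> = t"
    using Node.IH(2) by blast
  have *: "[m..<m + (?k + ?l)] = [m..<m + ?k] @ [m + ?k..<m + ?k + ?l]"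
    using upt_add_eq_append[of m "m + ?k" ?l] by (simp add: add.assoc)
  show ?case
    by (rule exI[of _ "Imp \<phi> \<psi>"]) (use \<phi> \<psi> in \<open>auto simp: *\<close>)
qed

lemma bij_betw_ltrees:
  "bij_betw (\<lambda>(\<phi>, v). label_formula v \<phi>)
     {(\<phi>, v). \<phi> \<in> bracketings n \<and> v \<in> valuations n \<and> eval_formula v \<phi> = c} (ltrees c n)"
  (is "bij_betw ?f ?A _")
proof (rule bij_betw_imageI)
  show "inj_on ?f ?A"
  proof (rule inj_onI, safe)
    fix \<phi> \<psi> v v'
    assume \<phi>: "\<phi> \<in> bracketings n" and \<psi>: "\<psi> \<in> bracketings n"
      and v: "v \<in> valuations n" "v' \<in> valuations n"
      and eq: "label_formula v \<phi> = label_formula v' \<psi>"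
    show "\<phi> = \<psi>"
      using eq \<phi> \<psi> by (intro label_formula_inject[of v _ v']) (auto simp: bracketings_def)
    have "map v [1..<Suc n] = map v' [1..<Suc n]"
      using arg_cong[OF eq, of labels] \<phi> \<psi> by (simp add: labels_label_formula bracketings_def)
    then have "v i = v' i" if "i \<in> {1..n}" for i
      using that by (auto simp del: upt_Suc)
    then show "v = v'"
      using v unfolding valuations_def by (intro PiE_ext) auto
  qed
  show "?f ` ?A = ltrees c n"
  proof (intro equalityI subsetI)
    fix t assume "t \<in> ?f ` ?A"
    then show "t \<in> ltrees c n"
      by (auto simp: ltrees_def ltree_value_label_formula labels_label_formula bracketings_def)
  next
    fix t assume t: "t \<in> ltrees c n"
    obtain \<phi> where \<phi>: "leaves \<phi> = [1..<Suc n]"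
      "\<And>v. map v [1..<Suc n] = labels t \<Longrightarrow> label_formula v \<phi> = t"
      using ex_label_formula[of 1 t] t by (auto simp: ltrees_def)
    \<comment> \<open>Variables count from 1 and list positions from 0. The restriction to
      \<open>{1..n}\<close> makes \<open>v\<close> extensional, as \<open>valuations\<close>
      demands.\<close>
    define v where "v = (\<lambda>i\<in>{1..n}. labels t ! (i - 1))"
    have "map v [1..<Suc n] = labels t"
      using t by (intro nth_equalityI) (auto simp: v_def ltrees_def simp del: upt_Suc)
    then have eq: "label_formula v \<phi> = t" by (rule \<phi>(2))
    have "eval_formula v \<phi> = c"
      using eq t ltree_value_label_formula[of v \<phi>] by (simp add: ltrees_def)
    moreover have "v \<in> valuations n" by (auto simp: v_def valuations_def)
    ultimately have "(\<phi>, v) \<in> ?A" using \<phi>(1) by (auto simp: bracketings_def)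
    then show "t \<in> ?f ` ?A" using eq by force
  qed
qed

lemma value_count_eq_card_ltrees: "value_count c n = card (ltrees c n)"
  unfolding value_count_def using bij_betw_ltrees by (rule bij_betw_same_card)

lemma finite_ltrees: "finite (ltrees c n)"
  using bij_betw_finite[OF bij_betw_ltrees] finite_value_count_set by blast

section \<open>Convolution recurrences for the counts\<close>

lemma value_count_0: "value_count c 0 = 0"
  by (simp add: value_count_eq_card_ltrees ltrees_def labels_nonempty)

text \<open>A tree is a leaf or splits uniquely at its root. The terms with \<open>i = 0\<close> and
  \<open>i = n\<close> vanish by \<open>value_count_0\<close>, so the sum may run over all
  \<open>i \<le> n\<close>.\<close>

lemma value_count_rec:
  "value_count c n = (if n = 1 then 1 else 0) +
     (\<Sum>i\<le>n. \<Sum>(x, y)\<in>{(x, y). goedel_imp x y = c}. value_count x i * value_count y (n - i))"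
proof -
  let ?P = "{(x, y). goedel_imp x y = c}"
  \<comment> \<open>The index records the size of the left subtree and the values of both
    subtrees.\<close>
  let ?S = "SIGMA p:{..n} \<times> ?P. ltrees (fst (snd p)) (fst p) \<times> ltrees (snd (snd p)) (n - fst p)"
  let ?N = "{t \<in> ltrees c n. \<exists>r s. t = Node r s}"
  have "bij_betw (\<lambda>(p, r, s). Node r s) ?S ?N"
  proof (rule bij_betw_imageI)
    show "inj_on (\<lambda>(p, r, s). Node r s) ?S"
      by (auto simp: inj_on_def ltrees_def)
    show "(\<lambda>(p, r, s). Node r s) ` ?S = ?N"
    proof (intro equalityI subsetI)
      fix t assume "t \<in> (\<lambda>(p, r, s). Node r s) ` ?S"
      then show "t \<in> ?N" by (auto simp: ltrees_def)
    next
      fix t assume "t \<in> ?N"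
      then obtain r s where t: "t = Node r s" "Node r s \<in> ltrees c n" by blast
      then have "((length (labels r), ltree_value r, ltree_value s), r, s) \<in> ?S"
        by (auto simp: ltrees_def)
      then show "t \<in> (\<lambda>(p, r, s). Node r s) ` ?S"
        using t(1) by force
    qed
  qed
  then have "card ?N = card ?S"
    by (rule bij_betw_same_card[symmetric])
  also have "\<dots> = (\<Sum>p\<in>{..n} \<times> ?P. value_count (fst (snd p)) (fst p) * value_count (snd (snd p)) (n - fst p))"
    by (subst card_SigmaI) (auto simp: finite_ltrees card_cartesian_product value_count_eq_card_ltrees)
  also have "\<dots> = (\<Sum>i\<le>n. \<Sum>(x, y)\<in>?P. value_count x i * value_count y (n - i))"
    by (simp add: sum.cartesian_product split_def)
  finally have N: "card ?N = \<dots>" .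
  have L: "{t \<in> ltrees c n. \<exists>x. t = Leaf x} = (if n = 1 then {Leaf c} else {})"
    by (auto simp: ltrees_def)
  have "ltrees c n = {t \<in> ltrees c n. \<exists>x. t = Leaf x} \<union> ?N"
  proof -
    have "(\<exists>x. t = Leaf x) \<or> (\<exists>r s. t = Node r s)" for t :: "V4 ltree"
      by (cases t) auto
    then show ?thesis by blast
  qed
  moreover have "{t \<in> ltrees c n. \<exists>x. t = Leaf x} \<inter> ?N = {}" by auto
  ultimately have "card (ltrees c n) = card {t \<in> ltrees c n. \<exists>x. t = Leaf x} + card ?N"
    using card_Un_disjoint[of "{t \<in> ltrees c n. \<exists>x. t = Leaf x}" ?N] finite_ltrees[of c n] by simp
  then show ?thesis
    unfolding value_count_eq_card_ltrees[of c n] N L by simp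
qed

lemma UNIV_V4: "(UNIV :: V4 set) = {V0, Va, Vb, V1}"
  using V4.exhaust by blast

lemma greaterThan_V4:
  "{V0<..} = {Va, Vb, V1}" "{Va<..} = {Vb, V1}" "{Vb<..} = {V1}"
proof -
  have "x \<in> {V0<..} \<longleftrightarrow> x \<in> {Va, Vb, V1}" "x \<in> {Va<..} \<longleftrightarrow> x \<in> {Vb, V1}"
    "x \<in> {Vb<..} \<longleftrightarrow> x \<in> {V1}" for x
    by (cases x; simp add: less_V4_def)+
  then show "{V0<..} = {Va, Vb, V1}" "{Va<..} = {Vb, V1}" "{Vb<..} = {V1}" by blast+
qed

lemma card_UNIV_V4: "CARD(V4) = 4"
  by (simp add: UNIV_V4)

text \<open>The implication returns either top or its right argument, the latter only if the left
  argument is strictly larger. So the pairs with value \<open>c\<close> form the product of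
  \<open>{c<..}\<close> and \<open>{c}\<close>.\<close>

lemma value_count_rec_nontop:
  assumes "c \<noteq> V1"
  shows "value_count c n = (if n = 1 then 1 else 0) +
     (\<Sum>i\<le>n. (\<Sum>x\<in>{c<..}. value_count x i) * value_count c (n - i))"
proof -
  have "{(x, y). goedel_imp x y = c} = {c<..} \<times> {c}"
    using assms by (auto simp: goedel_imp_def top_V4_def split: if_splits)
  then show ?thesis
    by (subst value_count_rec) (simp add: sum.cartesian_product[symmetric] sum_distrib_right)
qed

lemma g_count_eq_sum: "g_count n = (\<Sum>c\<in>UNIV. value_count c n)"
  by (simp add: g_count_def f_count_def a_count_def b_count_def t_count_def UNIV_V4)

text \<open>Summed over all results \<open>c\<close>, each pair of values of the two parts occurs
  exactly once, and the double sum factors.\<close>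

lemma g_count_rec:
  "g_count n = (if n = 1 then 4 else 0) + (\<Sum>i\<le>n. g_count i * g_count (n - i))"
proof -
  have "g_count n = (\<Sum>c\<in>(UNIV :: V4 set). if n = 1 then 1 else 0) +
     (\<Sum>i\<le>n. \<Sum>c\<in>UNIV. \<Sum>(x, y)\<in>{p. p \<in> UNIV \<and> (\<lambda>(x, y). goedel_imp x y) p = c}.
        value_count x i * value_count y (n - i))"
    unfolding g_count_eq_sum
    by (subst value_count_rec, subst sum.distrib, subst (2) sum.swap) (simp add: split_def)
  also have "\<dots> = (if n = 1 then 4 else 0) +
     (\<Sum>i\<le>n. \<Sum>(x, y)\<in>UNIV. value_count x i * value_count y (n - i))"
    by (subst sum.group) (simp_all add: card_UNIV_V4)
  also have "\<dots> = (if n = 1 then 4 else 0) + (\<Sum>i\<le>n. g_count i * g_count (n - i))"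
    by (simp add: g_count_eq_sum sum_product sum.cartesian_product flip: UNIV_Times_UNIV)
  finally show ?thesis .
qed

lemma f_count_rec:
  "f_count n = (if n = 1 then 1 else 0) + (\<Sum>i\<le>n. (a_count i + b_count i + t_count i) * f_count (n - i))"
  using value_count_rec_nontop[of V0 n]
  by (simp add: greaterThan_V4 f_count_def a_count_def b_count_def t_count_def add.assoc)

lemma a_count_rec:
  "a_count n = (if n = 1 then 1 else 0) + (\<Sum>i\<le>n. (b_count i + t_count i) * a_count (n - i))"
  using value_count_rec_nontop[of Va n]
  by (simp add: greaterThan_V4 a_count_def b_count_def t_count_def)

lemma b_count_rec:
  "b_count n = (if n = 1 then 1 else 0) + (\<Sum>i\<le>n. t_count i * b_count (n - i))"
  using value_count_rec_nontop[of Vb n]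
  by (simp add: greaterThan_V4 b_count_def t_count_def)

subsection \<open>Subexponential sequences\<close>

lemma sum_split_ends:
  fixes f :: "nat \<Rightarrow> 'a::comm_monoid_add"
  assumes "2 * M < n"
  shows "(\<Sum>i\<le>n. f i) = (\<Sum>i\<le>M. f i) + (\<Sum>i\<in>{M<..<n - M}. f i) + (\<Sum>i\<le>M. f (n - i))"
proof -
  have "{..n} = {..M} \<union> {M<..<n - M} \<union> {n - M..n}" using assms by auto
  then have "(\<Sum>i\<le>n. f i) = (\<Sum>i\<in>{..M} \<union> {M<..<n - M} \<union> {n - M..n}. f i)" by simp
  also have "\<dots> = (\<Sum>i\<le>M. f i) + (\<Sum>i\<in>{M<..<n - M}. f i) + (\<Sum>i\<in>{n - M..n}. f i)"
    using assms by (subst sum.union_disjoint; (subst sum.union_disjoint)?) auto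
  also have "(\<Sum>i\<in>{n - M..n}. f i) = (\<Sum>i\<le>M. f (n - i))"
    using assms by (intro sum.reindex_bij_witness[of _ "\<lambda>i. n - i" "\<lambda>i. n - i"]) auto
  finally show ?thesis .
qed

text \<open>The last condition says that in the self-convolution one of the two indices carries
  nearly all of \<open>n\<close>, each side contributing \<open>suminf w\<close> times
  \<open>w n\<close>.\<close>

locale subexponential =
  fixes w :: "nat \<Rightarrow> real"
  assumes nonneg: "w n \<ge> 0"
    and pos: "\<forall>\<^sub>F n in sequentially. w n > 0"
    and ratio: "(\<lambda>n. w (Suc n) / w n) \<longlonglongrightarrow> 1"
    and summable: "summable w"
    and conv: "(\<lambda>n. (\<Sum>i\<le>n. w i * w (n - i)) / w n) \<longlonglongrightarrow> 2 * suminf w"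
begin

lemma shift_ratio: "(\<lambda>n. w (n - i) / w n) \<longlonglongrightarrow> 1"
proof (induction i)
  case 0
  have "\<forall>\<^sub>F n in sequentially. w (n - 0) / w n = 1"
    using pos by eventually_elim simp
  then show ?case by (rule tendsto_eventually)
next
  case (Suc i)
  have "(\<lambda>n. inverse (w (Suc n) / w n)) \<longlonglongrightarrow> inverse 1"
    by (intro tendsto_inverse ratio) simp
  then have "(\<lambda>n. w n / w (Suc n)) \<longlonglongrightarrow> 1" by simp
  then have 1: "(\<lambda>n. w (n - 1) / w n) \<longlonglongrightarrow> 1"
    by (subst filterlim_sequentially_Suc[symmetric]) simp
  have "filterlim (\<lambda>n. n - i) sequentially sequentially"
    by (simp add: filterlim_minus_const_nat_at_top)
  from filterlim_compose[OF 1 this]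
  have "(\<lambda>n. w (n - i - 1) / w (n - i) * (w (n - i) / w n)) \<longlonglongrightarrow> 1 * 1"
    by (intro tendsto_mult Suc.IH)
  moreover have "\<forall>\<^sub>F n in sequentially. w (n - i) > 0"
    using pos eventually_compose_filterlim[OF pos] \<open>filterlim (\<lambda>n. n - i) _ _\<close> by blast
  then have "\<forall>\<^sub>F n in sequentially. w (n - i - 1) / w (n - i) * (w (n - i) / w n) = w (n - Suc i) / w n"
    by eventually_elim simp
  ultimately show ?case
    using Lim_transform_eventually by fastforce
qed

lemma shift_bound:
  assumes "\<forall>\<^sub>F n in sequentially. \<bar>v n - \<mu> * w n\<bar> \<le> D * w n" and "0 \<le> D" and "0 < \<epsilon>"
  shows "\<forall>\<^sub>F n in sequentially. \<bar>v (n - i) - \<mu> * w n\<bar> \<le> (D + \<epsilon>) * w n"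
proof -
  \<comment> \<open>Replacing \<open>w (n - i)\<close> by \<open>w n\<close> costs
    \<open>(D + \<bar>\<mu>\<bar>) * \<kappa>\<close>, which this choice keeps below \<epsilon>. The
    summand 1 makes the denominator positive.\<close>
  define \<kappa> where "\<kappa> = \<epsilon> / (D + \<bar>\<mu>\<bar> + 1)"
  have \<kappa>: "\<kappa> > 0" "(D + \<bar>\<mu>\<bar>) * \<kappa> \<le> \<epsilon>"
    using assms by (auto simp: \<kappa>_def field_simps)
  have lim: "filterlim (\<lambda>n. n - i) sequentially sequentially"
    by (simp add: filterlim_minus_const_nat_at_top)
  have "\<forall>\<^sub>F n in sequentially. \<bar>w (n - i) / w n - 1\<bar> < \<kappa>"
    using tendstoD[OF shift_ratio \<kappa>(1)] by (simp add: dist_real_def)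
  with eventually_compose_filterlim[OF assms(1) lim] pos show ?thesis
  proof eventually_elim
    case (elim n)
    have "\<bar>w (n - i) - w n\<bar> = \<bar>w (n - i) / w n - 1\<bar> * w n"
      using elim by (simp add: field_simps flip: abs_mult_pos)
    also have "\<dots> \<le> \<kappa> * w n"
      using elim by (intro mult_right_mono) auto
    finally have *: "\<bar>w (n - i) - w n\<bar> \<le> \<kappa> * w n" .
    have "\<bar>v (n - i) - \<mu> * w n\<bar> \<le> \<bar>v (n - i) - \<mu> * w (n - i)\<bar> + \<bar>\<mu> * (w (n - i) - w n)\<bar>"
      by (simp add: algebra_simps)
    also have "\<dots> \<le> D * w (n - i) + \<bar>\<mu>\<bar> * \<bar>w (n - i) - w n\<bar>"
      using elim by (simp add: abs_mult)
    also have "\<dots> \<le> D * (w n + \<kappa> * w n) + \<bar>\<mu>\<bar> * (\<kappa> * w n)"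
      using * assms by (intro add_mono mult_left_mono) auto
    also have "\<dots> = (D + (D + \<bar>\<mu>\<bar>) * \<kappa>) * w n" by (simp add: algebra_simps)
    also have "\<dots> \<le> (D + \<epsilon>) * w n"
      using \<kappa> elim by (intro mult_right_mono) auto
    finally show ?case .
  qed
qed

text \<open>With \<open>M\<close> fixed only finitely many shifts occur, so
  \<open>shift_bound\<close> holds for all of them at once from some \<open>n\<close> on.\<close>

lemma partial_conv_bound:
  assumes v: "\<forall>\<^sub>F n in sequentially. \<bar>v n - \<mu> * w n\<bar> \<le> D * w n" and "0 \<le> D" and "0 < \<epsilon>"
    and u: "\<And>n. 0 \<le> u n"
  shows "\<forall>\<^sub>F n in sequentially. \<bar>(\<Sum>i\<le>M. u i * v (n - i)) - \<mu> * (\<Sum>i\<le>M. u i) * w n\<bar>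
           \<le> (D + \<epsilon>) * (\<Sum>i\<le>M. u i) * w n"
proof -
  have "\<forall>\<^sub>F n in sequentially. \<forall>i\<in>{..M}. \<bar>v (n - i) - \<mu> * w n\<bar> \<le> (D + \<epsilon>) * w n"
    using shift_bound assms by (intro eventually_ball_finite) auto
  then show ?thesis
  proof eventually_elim
    case (elim n)
    have "\<bar>(\<Sum>i\<le>M. u i * v (n - i)) - \<mu> * (\<Sum>i\<le>M. u i) * w n\<bar> = \<bar>\<Sum>i\<le>M. u i * (v (n - i) - \<mu> * w n)\<bar>"
      by (simp add: sum_subtractf algebra_simps sum_distrib_left sum_distrib_right)
    also have "\<dots> \<le> (\<Sum>i\<le>M. u i * \<bar>v (n - i) - \<mu> * w n\<bar>)"
      using u by (intro order.trans[OF sum_abs] sum_mono) (simp add: abs_mult)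
    also have "\<dots> \<le> (\<Sum>i\<le>M. u i * ((D + \<epsilon>) * w n))"
      using elim u by (intro sum_mono mult_left_mono) auto
    finally show ?case by (simp add: sum_distrib_left sum_distrib_right mult_ac)
  qed
qed

text \<open>Of the limit \<open>2 * suminf w\<close> for the whole convolution over
  \<open>w n\<close>, the two end blocks take twice the partial sum up to \<open>M\<close>. What is
  left for the middle is twice a tail of a convergent series.\<close>

lemma middle_small:
  assumes "0 < \<epsilon>"
  shows "\<forall>\<^sub>F M in sequentially. \<forall>\<^sub>F n in sequentially. (\<Sum>i\<in>{M<..<n - M}. w i * w (n - i)) \<le> \<epsilon> * w n"
proof -
  have "(\<lambda>M. \<Sum>i\<le>M. w i) \<longlonglongrightarrow> suminf w"
    by (rule summable_LIMSEQ'[OF summable])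
  then have "(\<lambda>M. 2 * suminf w - 2 * (\<Sum>i\<le>M. w i)) \<longlonglongrightarrow> 2 * suminf w - 2 * suminf w"
    by (intro tendsto_intros)
  then have "\<forall>\<^sub>F M in sequentially. 2 * suminf w - 2 * (\<Sum>i\<le>M. w i) < \<epsilon>"
    using assms by (intro order_tendstoD(2)) auto
  then show ?thesis
  proof eventually_elim
    case (elim M)
    have "(\<lambda>n. (\<Sum>i\<le>n. w i * w (n - i)) / w n - 2 * (\<Sum>i\<le>M. w i * (w (n - i) / w n)))
        \<longlonglongrightarrow> 2 * suminf w - 2 * (\<Sum>i\<le>M. w i * 1)"
      by (intro tendsto_intros conv shift_ratio)
    then have "\<forall>\<^sub>F n in sequentially.
        (\<Sum>i\<le>n. w i * w (n - i)) / w n - 2 * (\<Sum>i\<le>M. w i * (w (n - i) / w n)) < \<epsilon>"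
      using elim by (intro order_tendstoD(2)) auto
    with pos eventually_gt_at_top[of "2 * M"] show ?case
    proof eventually_elim
      case (elim n)
      have "(\<Sum>i\<le>M. w (n - i) * w (n - (n - i))) = (\<Sum>i\<le>M. w i * w (n - i))"
        using elim by (intro sum.cong) auto
      then have "(\<Sum>i\<in>{M<..<n - M}. w i * w (n - i))
          = (\<Sum>i\<le>n. w i * w (n - i)) - 2 * (\<Sum>i\<le>M. w i * w (n - i))"
        using sum_split_ends[of M n "\<lambda>i. w i * w (n - i)"] elim by simp
      also have "\<dots> = ((\<Sum>i\<le>n. w i * w (n - i)) / w n - 2 * (\<Sum>i\<le>M. w i * (w (n - i) / w n))) * w n"
        using elim by (simp add: left_diff_distrib flip: sum_divide_distrib)
      also have "\<dots> \<le> \<epsilon> * w n"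
        using elim by (intro mult_right_mono) auto
      finally show ?case .
    qed
  qed
qed

lemma summable_dominated:
  assumes "\<And>n. 0 \<le> u n" "\<And>n. u n \<le> w n"
  shows "summable u"
  by (rule summable_comparison_test'[OF summable, of 0]) (use assms in auto)

text \<open>In the first block \<open>v (n - i)\<close> is close to \<open>\<mu> * w n\<close>, in
  the last block \<open>u\<close> is close to \<open>\<nu> * w n\<close>, and the middle is
  dominated by that of \<open>w\<close>. The errors \<open>D\<close> and \<open>E\<close> need not
  be small: the contraction argument below applies this before any limit is known to exist.\<close>

lemma conv_bound:
  assumes u: "\<And>n. 0 \<le> u n" "\<And>n. u n \<le> w n" and v: "\<And>n. 0 \<le> v n" "\<And>n. v n \<le> w n"
    and u': "\<forall>\<^sub>F n in sequentially. \<bar>u n - \<nu> * w n\<bar> \<le> D * w n" and D: "0 \<le> D"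
    and v': "\<forall>\<^sub>F n in sequentially. \<bar>v n - \<mu> * w n\<bar> \<le> E * w n" and E: "0 \<le> E"
    and \<epsilon>: "0 < \<epsilon>"
  shows "\<forall>\<^sub>F n in sequentially.
    \<bar>(\<Sum>i\<le>n. u i * v (n - i)) - (\<nu> * suminf v + \<mu> * suminf u) * w n\<bar>
      \<le> (D * suminf v + E * suminf u + \<epsilon>) * w n"
proof -
  define U where "U = suminf u"
  define V where "V = suminf v"
  have su: "summable u" and sv: "summable v"
    using u v by (auto intro: summable_dominated)
  have UV: "0 \<le> U" "0 \<le> V"
    unfolding U_def V_def using su sv u v by (auto intro: suminf_nonneg)
  \<comment> \<open>One quarter of \<epsilon> each pays for the shifts in the end blocks, the middle
    block, and the passage from partial sums to full sums.\<close>
  define \<delta> where "\<delta> = \<epsilon> / (4 * (U + V + 1))"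
  have \<delta>: "0 < \<delta>" "\<delta> * (U + V) \<le> \<epsilon> / 4"
    using \<epsilon> UV by (auto simp: \<delta>_def field_simps add_pos_nonneg)
  have "(\<lambda>M. \<bar>\<mu>\<bar> * (U - (\<Sum>i\<le>M. u i)) + \<bar>\<nu>\<bar> * (V - (\<Sum>i\<le>M. v i))) \<longlonglongrightarrow> \<bar>\<mu>\<bar> * (U - U) + \<bar>\<nu>\<bar> * (V - V)"
    unfolding U_def V_def by (intro tendsto_intros summable_LIMSEQ' su sv)
  then have "\<forall>\<^sub>F M in sequentially. \<bar>\<mu>\<bar> * (U - (\<Sum>i\<le>M. u i)) + \<bar>\<nu>\<bar> * (V - (\<Sum>i\<le>M. v i)) < \<epsilon> / 4"
    using \<epsilon> by (intro order_tendstoD(2)) auto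
  with middle_small[of "\<epsilon> / 4"] \<epsilon>
  have "\<forall>\<^sub>F M in sequentially. (\<forall>\<^sub>F n in sequentially. (\<Sum>i\<in>{M<..<n - M}. w i * w (n - i)) \<le> \<epsilon> / 4 * w n) \<and>
     \<bar>\<mu>\<bar> * (U - (\<Sum>i\<le>M. u i)) + \<bar>\<nu>\<bar> * (V - (\<Sum>i\<le>M. v i)) < \<epsilon> / 4"
    by (simp add: eventually_conj)
  then obtain M where
    M1: "\<forall>\<^sub>F n in sequentially. (\<Sum>i\<in>{M<..<n - M}. w i * w (n - i)) \<le> \<epsilon> / 4 * w n"
    and M2: "\<bar>\<mu>\<bar> * (U - (\<Sum>i\<le>M. u i)) + \<bar>\<nu>\<bar> * (V - (\<Sum>i\<le>M. v i)) < \<epsilon> / 4"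
    using eventually_happens'[OF sequentially_bot] by blast
  define U' where "U' = (\<Sum>i\<le>M. u i)"
  define V' where "V' = (\<Sum>i\<le>M. v i)"
  have U': "U' \<le> U" "0 \<le> U'" and V': "V' \<le> V" "0 \<le> V'"
    unfolding U_def V_def U'_def V'_def using su sv u v by (auto intro: sum_le_suminf sum_nonneg)
  from M1 partial_conv_bound[where u = u and M = M, OF v' E \<delta>(1) u(1)]
    partial_conv_bound[where u = v and M = M, OF u' D \<delta>(1) v(1)] eventually_gt_at_top[of "2 * M"] pos
  show ?thesis
    unfolding U_def[symmetric] V_def[symmetric] U'_def[symmetric] V'_def[symmetric]
  proof eventually_elim
    case (elim n)
    let ?m = "\<Sum>i\<in>{M<..<n - M}. u i * v (n - i)"
    let ?x = "\<Sum>i\<le>M. u i * v (n - i)" and ?y = "\<Sum>i\<le>M. v i * u (n - i)"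
    have "(\<Sum>i\<le>M. u (n - i) * v (n - (n - i))) = ?y"
      using elim by (intro sum.cong) auto
    then have split: "(\<Sum>i\<le>n. u i * v (n - i)) = ?x + ?m + ?y"
      using sum_split_ends[of M n "\<lambda>i. u i * v (n - i)"] elim by simp
    have m0: "0 \<le> ?m" using u v by (intro sum_nonneg) auto
    have "?m \<le> (\<Sum>i\<in>{M<..<n - M}. w i * w (n - i))"
      using u v nonneg by (intro sum_mono mult_mono) auto
    then have m1: "?m \<le> \<epsilon> / 4 * w n" using elim by simp
    have "\<bar>\<mu> * (U - U') * w n + \<nu> * (V - V') * w n\<bar> \<le> \<bar>\<mu> * (U - U') * w n\<bar> + \<bar>\<nu> * (V - V') * w n\<bar>"
      by (rule abs_triangle_ineq)
    also have "\<dots> = (\<bar>\<mu>\<bar> * (U - U') + \<bar>\<nu>\<bar> * (V - V')) * w n"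
      using U' V' elim by (simp add: abs_mult distrib_right)
    also have "\<dots> \<le> \<epsilon> / 4 * w n"
      using M2 elim unfolding U'_def V'_def by (intro mult_right_mono) auto
    finally have tail: "\<bar>\<mu> * (U - U') * w n + \<nu> * (V - V') * w n\<bar> \<le> \<epsilon> / 4 * w n" .
    have "(E + \<delta>) * U' + (D + \<delta>) * V' \<le> (E + \<delta>) * U + (D + \<delta>) * V"
      using U' V' D E \<delta> by (intro add_mono mult_left_mono) auto
    also have "\<dots> \<le> D * V + E * U + \<epsilon> / 4"
      using \<delta> by (simp add: algebra_simps)
    finally have "((E + \<delta>) * U' + (D + \<delta>) * V') * w n \<le> (D * V + E * U + \<epsilon> / 4) * w n"
      using elim by (intro mult_right_mono) auto
    then have ends: "\<bar>?x - \<mu> * U' * w n\<bar> + \<bar>?y - \<nu> * V' * w n\<bar> \<le> (D * V + E * U + \<epsilon> / 4) * w n"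
      using elim by (simp add: algebra_simps)
    have "?x + ?m + ?y - (\<nu> * V + \<mu> * U) * w n =
       (?x - \<mu> * U' * w n) + (?y - \<nu> * V' * w n) + ?m - (\<mu> * (U - U') * w n + \<nu> * (V - V') * w n)"
      by (simp add: algebra_simps)
    then have "\<bar>?x + ?m + ?y - (\<nu> * V + \<mu> * U) * w n\<bar>
       \<le> (\<bar>?x - \<mu> * U' * w n\<bar> + \<bar>?y - \<nu> * V' * w n\<bar>) + \<bar>?m\<bar> + \<bar>\<mu> * (U - U') * w n + \<nu> * (V - V') * w n\<bar>"
      by linarith
    also have "\<dots> \<le> (D * V + E * U + \<epsilon> / 4) * w n + \<epsilon> / 4 * w n + \<epsilon> / 4 * w n"
      using ends m0 m1 tail by (intro add_mono) auto
    also have "\<dots> = (D * V + E * U + 3 / 4 * \<epsilon>) * w n"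
      by (simp add: algebra_simps)
    also have "\<dots> \<le> (D * V + E * U + \<epsilon>) * w n"
      using elim \<epsilon> by (intro mult_right_mono) auto
    finally show ?case unfolding split .
  qed
qed

section \<open>Limits for quadratic convolution equations\<close>

lemma tendsto_ratio_iff:
  "(\<lambda>n. h n / w n) \<longlonglongrightarrow> \<eta> \<longleftrightarrow> (\<forall>\<epsilon>>0. \<forall>\<^sub>F n in sequentially. \<bar>h n - \<eta> * w n\<bar> \<le> \<epsilon> * w n)"
proof -
  have *: "(\<bar>h n / w n - \<eta>\<bar> \<le> \<epsilon>) = (\<bar>h n - \<eta> * w n\<bar> \<le> \<epsilon> * w n)" if "w n > 0" for n \<epsilon>
  proof -
    have "h n / w n - \<eta> = (h n - \<eta> * w n) / w n" using that by (simp add: field_simps)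
    then show ?thesis using that by (simp add: field_simps)
  qed
  have "(\<forall>\<^sub>F n in sequentially. \<bar>h n / w n - \<eta>\<bar> \<le> \<epsilon>) =
     (\<forall>\<^sub>F n in sequentially. \<bar>h n - \<eta> * w n\<bar> \<le> \<epsilon> * w n)" for \<epsilon>
    by (intro eventually_subst eventually_mono[OF pos] *)
  moreover have "(\<lambda>n. h n / w n) \<longlonglongrightarrow> \<eta> \<longleftrightarrow> (\<forall>\<epsilon>>0. \<forall>\<^sub>F n in sequentially. \<bar>h n / w n - \<eta>\<bar> \<le> \<epsilon>)"
    (is "_ \<longleftrightarrow> ?R")
  proof
    assume "(\<lambda>n. h n / w n) \<longlonglongrightarrow> \<eta>"
    then show ?R
      by (fastforce simp: tendsto_iff dist_real_def elim: eventually_mono)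
  next
    assume R: ?R
    show "(\<lambda>n. h n / w n) \<longlonglongrightarrow> \<eta>"
    proof (rule tendstoI)
      fix e :: real assume "e > 0"
      then have "\<forall>\<^sub>F n in sequentially. \<bar>h n / w n - \<eta>\<bar> \<le> e / 2"
        using R half_gt_zero by blast
      then show "\<forall>\<^sub>F n in sequentially. dist (h n / w n) \<eta> < e"
        by eventually_elim (use \<open>e > 0\<close> in \<open>auto simp: dist_real_def\<close>)
    qed
  qed
  ultimately show ?thesis by simp
qed

text \<open>The candidate limit solves a linear fixed-point equation. Feeding an asymptotic error
  bound for \<open>a\<close> through the recurrence multiplies it by \<open>suminf h < 1\<close>, up
  to an arbitrarily small addition, so the best such bound is 0.\<close>

lemma tendsto_ratio_of_quadratic:
  assumes h: "\<And>n. h n \<le> w n" "(\<lambda>n. h n / w n) \<longlonglongrightarrow> \<eta>" "suminf h < 1"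
    and a: "\<And>n. 0 \<le> a n" "\<And>n. a n \<le> h n"
    and rec: "\<forall>\<^sub>F n in sequentially. a n = (\<Sum>i\<le>n. (h i - a i) * a (n - i))"
  shows "(\<lambda>n. a n / w n) \<longlonglongrightarrow> \<eta> * suminf a / (1 - suminf h + 2 * suminf a)"
proof -
  define k where "k n = h n - a n" for n
  have aw: "a n \<le> w n" for n using a h order.trans by blast
  have kw: "0 \<le> k n" "k n \<le> w n" for n using a[of n] h(1)[of n] by (auto simp: k_def)
  have h0: "0 \<le> h n" for n using a[of n] by linarith
  have sa: "summable a" and sh: "summable h"
    using a h h0 aw by (auto intro: summable_dominated)
  have K: "suminf k = suminf h - suminf a"
    unfolding k_def using suminf_diff[OF sh sa] by simp
  have A0: "0 \<le> suminf a" and H0: "0 \<le> suminf h"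
    using sa sh a h0 by (auto intro: suminf_nonneg)
  define \<nu> where "\<nu> = \<eta> * suminf a / (1 - suminf h + 2 * suminf a)"
  have \<nu>: "(\<eta> - \<nu>) * suminf a + \<nu> * suminf k = \<nu>"
  proof -
    have "\<nu> * (1 - suminf h + 2 * suminf a) = \<eta> * suminf a"
      using A0 h(3) by (simp add: \<nu>_def)
    then show ?thesis by (simp add: K algebra_simps)
  qed
  define S where "S = {D. 0 \<le> D \<and> (\<forall>\<^sub>F n in sequentially. \<bar>a n - \<nu> * w n\<bar> \<le> D * w n)}"
  \<comment> \<open>The errors \<open>D + \<delta>\<close> of \<open>k\<close> and \<open>D\<close>
    of \<open>a\<close> are weighted with \<open>suminf a\<close> and \<open>suminf k\<close>, and
    these weights add up to \<open>suminf h\<close>.\<close>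
  have step: "suminf h * D + \<epsilon> \<in> S" if D: "D \<in> S" and \<epsilon>: "0 < \<epsilon>" for D \<epsilon>
  proof -
    define \<delta> where "\<delta> = \<epsilon> / (2 * (suminf a + 1))"
    have \<delta>: "0 < \<delta>" "\<delta> * suminf a \<le> \<epsilon> / 2"
      using A0 \<epsilon> by (auto simp: \<delta>_def field_simps)
    have Da: "0 \<le> D" "\<forall>\<^sub>F n in sequentially. \<bar>a n - \<nu> * w n\<bar> \<le> D * w n"
      using D by (auto simp: S_def)
    have "\<forall>\<^sub>F n in sequentially. \<bar>h n - \<eta> * w n\<bar> \<le> \<delta> * w n"
      using h(2) \<delta>(1) by (simp add: tendsto_ratio_iff)
    with Da(2) have Dk: "\<forall>\<^sub>F n in sequentially. \<bar>k n - (\<eta> - \<nu>) * w n\<bar> \<le> (D + \<delta>) * w n"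
      by eventually_elim (simp add: k_def algebra_simps)
    have "0 \<le> D + \<delta>" "0 < \<epsilon> / 2" using Da(1) \<delta>(1) \<epsilon> by auto
    have "\<forall>\<^sub>F n in sequentially. \<bar>a n - \<nu> * w n\<bar> \<le> (suminf h * D + \<epsilon>) * w n"
      using conv_bound[OF kw a(1) aw Dk \<open>0 \<le> D + \<delta>\<close> Da(2,1) \<open>0 < \<epsilon> / 2\<close>] rec pos
    proof eventually_elim
      case (elim n)
      have "(D + \<delta>) * suminf a + D * suminf k + \<epsilon> / 2 \<le> suminf h * D + \<epsilon>"
        using \<delta> by (simp add: K algebra_simps)
      then have "((D + \<delta>) * suminf a + D * suminf k + \<epsilon> / 2) * w n \<le> (suminf h * D + \<epsilon>) * w n"
        using elim by (intro mult_right_mono) auto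
      moreover have "a n = (\<Sum>i\<le>n. k i * a (n - i))" using elim by (simp add: k_def)
      ultimately show ?case using elim(1) unfolding \<nu> by (metis order.trans)
    qed
    then show ?thesis using Da(1) H0 \<epsilon> by (simp add: S_def)
  qed
  have bdd: "bdd_below S" by (rule bdd_belowI[of _ 0]) (simp add: S_def)
  \<comment> \<open>The crude bound from \<open>0 \<le> a n \<le> w n\<close> starts the
    contraction.\<close>
  have "1 + \<bar>\<nu>\<bar> \<in> S"
  proof -
    have "\<bar>a n - \<nu> * w n\<bar> \<le> (1 + \<bar>\<nu>\<bar>) * w n" for n
    proof -
      have "\<bar>a n - \<nu> * w n\<bar> \<le> \<bar>a n\<bar> + \<bar>\<nu> * w n\<bar>" by (rule abs_triangle_ineq4)
      also have "\<dots> \<le> (1 + \<bar>\<nu>\<bar>) * w n"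
        using a(1)[of n] aw[of n] nonneg[of n] by (simp add: abs_mult algebra_simps)
      finally show ?thesis .
    qed
    then show ?thesis by (simp add: S_def)
  qed
  then have ne: "S \<noteq> {}" by blast
  have "Inf S \<le> 0"
  proof (rule ccontr)
    assume "\<not> Inf S \<le> 0"
    then have d: "0 < Inf S" by simp
    \<comment> \<open>A strict contraction leaves the gap \<open>(1 - suminf h) * Inf S\<close>,
      which is \<open>2 * \<theta>\<close>. Choosing \<open>D\<close> near the infimum costs at most
      \<theta> and the step half of \<theta>, so \<open>Inf S\<close> would lie below
      itself.\<close>
    define \<theta> where "\<theta> = (1 - suminf h) * Inf S / 2"
    have \<theta>: "0 < \<theta>" using d h(3) by (simp add: \<theta>_def)
    then obtain D where D: "D \<in> S" "D < Inf S + \<theta>"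
      using cInf_lessD[OF ne, of "Inf S + \<theta>"] by auto
    have "Inf S \<le> suminf h * D + \<theta> / 2"
      using step[OF D(1)] \<theta> bdd by (intro cInf_lower) auto
    also have "\<dots> \<le> suminf h * (Inf S + \<theta>) + \<theta> / 2"
      using D H0 by (intro add_mono mult_left_mono) auto
    also have "\<dots> \<le> suminf h * Inf S + \<theta> + \<theta> / 2"
      using h(3) H0 \<theta> by (simp add: distrib_left mult_left_le_one_le)
    also have "\<dots> < suminf h * Inf S + 2 * \<theta>" using \<theta> by simp
    also have "\<dots> = Inf S" by (simp add: \<theta>_def field_simps)
    finally show False by simp
  qed
  have "\<forall>\<^sub>F n in sequentially. \<bar>a n - \<nu> * w n\<bar> \<le> \<epsilon> * w n" if \<epsilon>: "0 < \<epsilon>" for \<epsilon>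
  proof -
    obtain D where D: "D \<in> S" "D < \<epsilon>"
      using cInf_lessD[OF ne, of \<epsilon>] \<open>Inf S \<le> 0\<close> \<epsilon> by auto
    then have "\<forall>\<^sub>F n in sequentially. \<bar>a n - \<nu> * w n\<bar> \<le> D * w n" by (simp add: S_def)
    with pos show ?thesis
    proof eventually_elim
      case (elim n)
      have "D * w n \<le> \<epsilon> * w n" using elim D by (intro mult_right_mono) auto
      then show ?case using elim by linarith
    qed
  qed
  then show ?thesis unfolding tendsto_ratio_iff \<nu>_def by blast
qed

text \<open>Summing the recurrence turns it into a quadratic equation for the sum of
  \<open>a\<close>, with \<open>s\<close> the root of its discriminant. The last two conclusions are
  the hypotheses for the next truth value, with \<open>h - a\<close> in place of
  \<open>h\<close>.\<close>

lemma quadratic_step: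
  assumes h: "\<And>n. h n \<le> w n" "(\<lambda>n. h n / w n) \<longlonglongrightarrow> \<eta>" "1 - suminf h = P" "0 < P"
    and a: "\<And>n. 0 \<le> a n" "\<And>n. a n \<le> h n"
    and rec: "\<And>n. a n = (if n = 1 then r else 0) + (\<Sum>i\<le>n. (h i - a i) * a (n - i))"
    and s: "s = sqrt (P\<^sup>2 + 4 * r)" and r: "0 < r"
  shows "(\<lambda>n. a n / w n) \<longlonglongrightarrow> \<eta> * (s - P) / (2 * s)"
    and "(\<lambda>n. (h n - a n) / w n) \<longlonglongrightarrow> \<eta> * (s + P) / (2 * s)"
    and "1 - (\<Sum>n. h n - a n) = (P + s) / 2"
proof -
  have aw: "a n \<le> w n" for n using a h order.trans by blast
  have h0: "0 \<le> h n" for n using a[of n] by linarith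
  have sa: "summable a" and sh: "summable h"
    using a h h0 aw by (auto intro: summable_dominated)
  have sk: "summable (\<lambda>n. h n - a n)" by (intro summable_diff sa sh)
  define A where "A = suminf a"
  have K: "(\<Sum>n. h n - a n) = 1 - P - A"
    using suminf_diff[OF sh sa] h(3) by (simp add: A_def)
  have A0: "0 \<le> A" unfolding A_def using sa a by (auto intro: suminf_nonneg)
  have "(\<lambda>n. \<Sum>i\<le>n. (h i - a i) * a (n - i)) sums ((\<Sum>n. h n - a n) * A)"
    unfolding A_def by (rule Cauchy_product_sums) (use sk sa a in auto)
  with sums_single[of 1 "\<lambda>_. r"]
  have "(\<lambda>n. (if n = 1 then r else 0) + (\<Sum>i\<le>n. (h i - a i) * a (n - i))) sums (r + (\<Sum>n. h n - a n) * A)"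
    by (intro sums_add)
  then have "a sums (r + (\<Sum>n. h n - a n) * A)" by (subst rec[abs_def])
  \<comment> \<open>That is, \<open>A\<^sup>2 + P * A = r\<close>. Completing the square and
    nonnegativity of \<open>P + 2 * A\<close> select the root.\<close>
  then have "A = r + (1 - P - A) * A" using K by (simp add: A_def sums_iff)
  then have "(P + 2 * A)\<^sup>2 = P\<^sup>2 + 4 * r" by (simp add: power2_eq_square algebra_simps)
  then have s': "s = P + 2 * A" unfolding s using h(4) A0 by (metis add_nonneg_nonneg less_imp_le
        mult_2 real_sqrt_unique)
  have s0: "0 < s" using s' A0 h(4) by simp
  have "\<forall>\<^sub>F n in sequentially. a n = (\<Sum>i\<le>n. (h i - a i) * a (n - i))"
    using eventually_gt_at_top[of 1] by eventually_elim (subst rec, simp)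
  then have "(\<lambda>n. a n / w n) \<longlonglongrightarrow> \<eta> * suminf a / (1 - suminf h + 2 * suminf a)"
    using h a by (intro tendsto_ratio_of_quadratic) auto
  moreover have "\<eta> * suminf a / (1 - suminf h + 2 * suminf a) = \<eta> * (s - P) / (2 * s)"
  proof -
    have "1 - suminf h + 2 * suminf a = s" "s - P = 2 * suminf a" using s' h(3) by (auto simp: A_def)
    then show ?thesis by simp
  qed
  ultimately show lim: "(\<lambda>n. a n / w n) \<longlonglongrightarrow> \<eta> * (s - P) / (2 * s)" by simp
  have "(\<lambda>n. h n / w n - a n / w n) \<longlonglongrightarrow> \<eta> - \<eta> * (s - P) / (2 * s)"
    by (intro tendsto_diff h lim)
  moreover have "\<eta> - \<eta> * (s - P) / (2 * s) = \<eta> * (s + P) / (2 * s)"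
    using s0 by (simp add: field_simps)
  ultimately show "(\<lambda>n. (h n - a n) / w n) \<longlonglongrightarrow> \<eta> * (s + P) / (2 * s)"
    by (simp add: diff_divide_distrib)
  show "1 - (\<Sum>n. h n - a n) = (P + s) / 2"
    using K s' by simp
qed

end

subsection \<open>The total count\<close>

text \<open>These are the coefficients of \<open>(1 - sqrt (1 - x)) / 2\<close>, that is, the
  Catalan number with index \<open>n - 1\<close> divided by \<open>4 ^ n\<close> for
  \<open>n \<ge> 1\<close>.\<close>

definition catalan_weight :: "nat \<Rightarrow> real" where
  "catalan_weight n = (if n = 0 then 0 else - ((- 1) ^ n * (1 / 2 gchoose n)) / 2)"

text \<open>Here \<open>z\<close> lists the coefficients of \<open>sqrt (1 - x)\<close>. Its
  self-convolution gives \<open>1 - x\<close> by the Vandermonde identity, and expanding the square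
  of \<open>(1 - z) / 2\<close> yields the recurrence.\<close>

lemma catalan_weight_conv:
  "catalan_weight n = (if n = 1 then 1 / 4 else 0) + (\<Sum>i\<le>n. catalan_weight i * catalan_weight (n - i))"
proof -
  define z :: "nat \<Rightarrow> real" where "z n = (- 1) ^ n * (1 / 2 gchoose n)" for n
  let ?d = "\<lambda>n::nat. if n = 0 then 1 else 0 :: real"
  have w: "catalan_weight n = (?d n - z n) / 2" for n
    by (simp add: catalan_weight_def z_def)
  have "(\<Sum>i\<le>n. z i * z (n - i)) = (- 1) ^ n * (\<Sum>i\<le>n. (1 / 2 gchoose i) * (1 / 2 gchoose (n - i)))"
    unfolding z_def sum_distrib_left
    by (intro sum.cong refl) (simp add: power_add[symmetric])
  also have "\<dots> = (- 1) ^ n * ((1::real) gchoose n)"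
    using gbinomial_Vandermonde[of "1 / 2 :: real" "1 / 2" n] by (simp add: atLeast0AtMost)
  also have "\<dots> = ?d n - (if n = 1 then 1 else 0)"
    using binomial_gbinomial[of 1 n, where 'a = real] by (cases "n \<le> 1") (auto simp: binomial_eq_0 le_Suc_eq)
  finally have zz: "(\<Sum>i\<le>n. z i * z (n - i)) = ?d n - (if n = 1 then 1 else 0)" .
  have "(\<Sum>i\<le>n. ?d i * ?d (n - i)) = (\<Sum>i\<le>n. if i = 0 then ?d n else 0)"
    by (intro sum.cong) auto
  then have dd: "(\<Sum>i\<le>n. ?d i * ?d (n - i)) = ?d n" by (simp add: sum.delta)
  have "(\<Sum>i\<le>n. ?d i * z (n - i)) = (\<Sum>i\<le>n. if i = 0 then z n else 0)"
    by (intro sum.cong) auto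
  then have dz: "(\<Sum>i\<le>n. ?d i * z (n - i)) = z n" by (simp add: sum.delta)
  have "(\<Sum>i\<le>n. z i * ?d (n - i)) = (\<Sum>i\<le>n. if i = n then z n else 0)"
    by (intro sum.cong) auto
  then have zd: "(\<Sum>i\<le>n. z i * ?d (n - i)) = z n" by (simp add: sum.delta)
  have "(\<Sum>i\<le>n. catalan_weight i * catalan_weight (n - i))
      = (\<Sum>i\<le>n. (?d i * ?d (n - i) - ?d i * z (n - i) - z i * ?d (n - i) + z i * z (n - i)) / 4)"
  proof -
    have "(a - b) / 2 * ((c - d) / 2) = (a * c - a * d - b * c + b * d) / 4" for a b c d :: real
      by (simp add: field_simps)
    then show ?thesis unfolding w by (simp only:)
  qed
  also have "\<dots> = ((\<Sum>i\<le>n. ?d i * ?d (n - i)) - (\<Sum>i\<le>n. ?d i * z (n - i)) - (\<Sum>i\<le>n. z i * ?d (n - i))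
      + (\<Sum>i\<le>n. z i * z (n - i))) / 4"
    by (simp only: sum_divide_distrib[symmetric] sum.distrib sum_subtractf)
  also have "\<dots> = (2 * ?d n - 2 * z n - (if n = 1 then 1 else 0)) / 4"
    unfolding dd dz zd zz by simp
  finally show ?thesis using w[of n] by auto
qed

lemma catalan_weight_Suc:
  assumes "n \<ge> 1"
  shows "catalan_weight (Suc n) = (real n - 1 / 2) / (real n + 1) * catalan_weight n"
proof -
  define q where "q = (real n - 1 / 2) / (real n + 1)"
  have "(1 / 2 gchoose Suc n) = - q * (1 / 2 gchoose n)"
    using gbinomial_mult_1[of "1 / 2 :: real" n] by (simp add: q_def field_simps)
  then show ?thesis using assms by (simp add: catalan_weight_def flip: q_def)
qed

lemma catalan_weight_pos: "n \<ge> 1 \<Longrightarrow> catalan_weight n > 0"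
proof (induction n rule: dec_induct)
  case base
  show ?case by (simp add: catalan_weight_def)
next
  case (step n)
  then show ?case by (auto simp: catalan_weight_Suc)
qed

lemma catalan_weight_nonneg: "catalan_weight n \<ge> 0"
  using catalan_weight_pos[of n] by (cases n) (auto simp: catalan_weight_def)

text \<open>As the entry at 0 vanishes, so do the two end terms of the convolution, and entry
  \<open>n\<close> is determined by strictly smaller ones.\<close>

lemma quadratic_convolution_unique:
  fixes x y :: "nat \<Rightarrow> 'a::comm_semiring_1"
  assumes "x 0 = 0" "\<And>n. x n = c n + (\<Sum>i\<le>n. x i * x (n - i))"
    and "y 0 = 0" "\<And>n. y n = c n + (\<Sum>i\<le>n. y i * y (n - i))"
  shows "x n = y n"
proof (induction n rule: less_induct)
  case (less n)
  have "x i * x (n - i) = y i * y (n - i)" if "i \<le> n" for i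
    using that assms(1,3) less[of i] less[of "n - i"] by (cases "i = 0 \<or> i = n") auto
  then show ?case
    using assms(2)[of n] assms(4)[of n] sum.cong[of "{..n}" "{..n}" "\<lambda>i. x i * x (n - i)" "\<lambda>i. y i * y (n - i)"]
    by simp
qed

text \<open>By the recurrence each partial sum is at most 1/4 plus the square of the preceding one,
  so the bound 1/2 reproduces itself.\<close>

lemma summable_catalan_weight: "summable catalan_weight"
proof (rule bounded_imp_summable[of _ "1 / 2"])
  show "catalan_weight n \<ge> 0" for n by (rule catalan_weight_nonneg)
  show "(\<Sum>k\<le>n. catalan_weight k) \<le> 1 / 2" for n
  proof (induction n)
    case 0
    show ?case by (simp add: catalan_weight_def)
  next
    case (Suc n)
    let ?w = catalan_weight
    let ?I = "{(i, j). i + j \<le> Suc n}" and ?J = "{(i, j). i + j \<le> Suc n \<and> i \<le> n \<and> j \<le> n}"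
    have "(\<Sum>k\<le>Suc n. ?w k) = (\<Sum>k\<le>Suc n. if k = 1 then 1 / 4 else 0) + (\<Sum>k\<le>Suc n. \<Sum>i\<le>k. ?w i * ?w (k - i))"
      unfolding sum.distrib[symmetric] by (intro sum.cong refl catalan_weight_conv)
    also have "(\<Sum>k\<le>Suc n. if k = 1 then 1 / 4 else 0) = (1 / 4 :: real)"
      by (subst sum.delta) auto
    also have "(\<Sum>k\<le>Suc n. \<Sum>i\<le>k. ?w i * ?w (k - i)) = (\<Sum>(i, j)\<in>?I. ?w i * ?w j)"
      by (rule sum.triangle_reindex_eq[symmetric])
    \<comment> \<open>If one index exceeds \<open>n\<close>, the other must be 0, where the weight
      is 0.\<close>
    also have "\<dots> = (\<Sum>(i, j)\<in>?J. ?w i * ?w j)"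
    proof (rule sum.mono_neutral_right)
      show "finite ?I" by (rule finite_subset[of _ "{..Suc n} \<times> {..Suc n}"]) auto
      show "\<forall>p\<in>?I - ?J. (case p of (i, j) \<Rightarrow> ?w i * ?w j) = 0"
      proof
        fix p assume "p \<in> ?I - ?J"
        then obtain i j where "p = (i, j)" "i + j \<le> Suc n" "\<not> (i \<le> n \<and> j \<le> n)" by blast
        moreover from this have "i = 0 \<or> j = 0" by linarith
        ultimately show "(case p of (i, j) \<Rightarrow> ?w i * ?w j) = 0" by (auto simp: catalan_weight_def)
      qed
    qed auto
    also have "\<dots> \<le> (\<Sum>(i, j)\<in>{..n} \<times> {..n}. ?w i * ?w j)"
      by (rule sum_mono2) (auto simp: catalan_weight_nonneg)
    also have "\<dots> = (\<Sum>k\<le>n. ?w k)\<^sup>2"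
      by (simp add: power2_eq_square sum_product sum.cartesian_product)
    also have "\<dots> \<le> (1 / 2)\<^sup>2"
      using Suc.IH by (intro power_mono) (auto intro: sum_nonneg catalan_weight_nonneg)
    finally show ?case by (simp add: power2_eq_square)
  qed
qed

text \<open>The sum satisfies \<open>W = 1 / 4 + W * W\<close>, whose double root is 1/2.\<close>

lemma suminf_catalan_weight: "suminf catalan_weight = 1 / 2"
proof -
  let ?W = "suminf catalan_weight"
  have "(\<lambda>n. \<Sum>i\<le>n. catalan_weight i * catalan_weight (n - i)) sums (?W * ?W)"
    by (rule Cauchy_product_sums) (use summable_catalan_weight catalan_weight_nonneg in auto)
  with sums_single[of 1 "\<lambda>_. 1 / 4 :: real"]
  have "(\<lambda>n. (if n = 1 then 1 / 4 else 0) + (\<Sum>i\<le>n. catalan_weight i * catalan_weight (n - i))) sums (1 / 4 + ?W * ?W)"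
    by (intro sums_add)
  then have "catalan_weight sums (1 / 4 + ?W * ?W)"
    by (subst catalan_weight_conv[abs_def])
  then have "?W = 1 / 4 + ?W * ?W" by (simp add: sums_iff)
  then have "(?W - 1 / 2)\<^sup>2 = 0" by (simp add: power2_eq_square algebra_simps)
  then show ?thesis by simp
qed

interpretation catalan: subexponential catalan_weight
proof
  show "catalan_weight n \<ge> 0" for n by (rule catalan_weight_nonneg)
  show pos: "\<forall>\<^sub>F n in sequentially. catalan_weight n > 0"
    using eventually_ge_at_top[of 1] by eventually_elim (rule catalan_weight_pos)
  have "\<forall>\<^sub>F n in sequentially. (real n - 1 / 2) / (real n + 1) = catalan_weight (Suc n) / catalan_weight n"
    using eventually_ge_at_top[of 1]
    by eventually_elim (use catalan_weight_pos in \<open>force simp: catalan_weight_Suc\<close>)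
  moreover have "(\<lambda>n. (real n - 1 / 2) / (real n + 1)) \<longlonglongrightarrow> 1"
  proof -
    have "(\<lambda>n. 1 - 3 / 2 * inverse (real (Suc n))) \<longlonglongrightarrow> 1 - 3 / 2 * 0"
      by (intro tendsto_intros LIMSEQ_inverse_real_of_nat)
    then show ?thesis by (simp add: field_simps)
  qed
  ultimately show "(\<lambda>n. catalan_weight (Suc n) / catalan_weight n) \<longlonglongrightarrow> 1"
    by (rule Lim_transform_eventually[rotated])
  show "summable catalan_weight" by (rule summable_catalan_weight)
  have "\<forall>\<^sub>F n in sequentially. (\<Sum>i\<le>n. catalan_weight i * catalan_weight (n - i)) / catalan_weight n = 2 * suminf catalan_weight"
    using eventually_gt_at_top[of 1] pos
  proof eventually_elim
    case (elim n)
    then have "(\<Sum>i\<le>n. catalan_weight i * catalan_weight (n - i)) = catalan_weight n"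
      by (subst (3) catalan_weight_conv) simp
    then show ?case using elim by (simp add: suminf_catalan_weight)
  qed
  then show "(\<lambda>n. (\<Sum>i\<le>n. catalan_weight i * catalan_weight (n - i)) / catalan_weight n) \<longlonglongrightarrow> 2 * suminf catalan_weight"
    by (rule tendsto_eventually)
qed

subsection \<open>The limits\<close>

text \<open>The scale 16 is the growth rate of the total count: 4 values per leaf times the growth
  rate 4 of the Catalan numbers.\<close>

lemma scaled_convolution:
  fixes a b c :: "nat \<Rightarrow> nat"
  assumes "a n = (if n = 1 then r else 0) + (\<Sum>i\<le>n. b i * c (n - i))"
  shows "real (a n) / 16 ^ n = (if n = 1 then real r / 16 else 0) +
    (\<Sum>i\<le>n. (real (b i) / 16 ^ i) * (real (c (n - i)) / 16 ^ (n - i)))"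
proof -
  have "(\<Sum>i\<le>n. (real (b i) / 16 ^ i) * (real (c (n - i)) / 16 ^ (n - i)))
      = (\<Sum>i\<le>n. real (b i * c (n - i)) / 16 ^ n)"
    by (intro sum.cong refl) (simp flip: power_add)
  then show ?thesis
    by (subst assms) (simp add: add_divide_distrib sum_divide_distrib)
qed

lemma g_count_eq_catalan_weight: "real (g_count n) / 16 ^ n = catalan_weight n"
proof (rule quadratic_convolution_unique)
  show "real (g_count 0) / 16 ^ 0 = 0"
    by (simp add: g_count_eq_sum value_count_0)
  show "real (g_count n) / 16 ^ n = (if n = 1 then 1 / 4 else 0) +
     (\<Sum>i\<le>n. (real (g_count i) / 16 ^ i) * (real (g_count (n - i)) / 16 ^ (n - i)))" for n
    using scaled_convolution[where a = g_count and b = g_count and c = g_count, OF g_count_rec[of n]] by (simp cong: if_cong)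
  show "catalan_weight 0 = 0" by (simp add: catalan_weight_def)
qed (rule catalan_weight_conv)

text \<open>Three rounds of \<open>quadratic_step\<close> peel off \<open>V0\<close>,
  \<open>Va\<close> and \<open>Vb\<close>. Before each round, \<open>P\<close> is 1 minus the sum of
  what remains; \<eta> is the limiting share of what remains, 1 at the start.\<close>

lemma count_limits:
  fixes P\<^sub>0 P\<^sub>1 P\<^sub>2 s\<^sub>0 s\<^sub>1 s\<^sub>2 :: real
  assumes P0: "P\<^sub>0 = 1 / 2" and s0: "s\<^sub>0 = sqrt (P\<^sub>0\<^sup>2 + 4 * (1 / 16))"
    and P1: "P\<^sub>1 = (P\<^sub>0 + s\<^sub>0) / 2" and s1: "s\<^sub>1 = sqrt (P\<^sub>1\<^sup>2 + 4 * (1 / 16))"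
    and P2: "P\<^sub>2 = (P\<^sub>1 + s\<^sub>1) / 2" and s2: "s\<^sub>2 = sqrt (P\<^sub>2\<^sup>2 + 4 * (1 / 16))"
    and \<eta>1: "\<eta>\<^sub>1 = (s\<^sub>0 + P\<^sub>0) / (2 * s\<^sub>0)" and \<eta>2: "\<eta>\<^sub>2 = \<eta>\<^sub>1 * (s\<^sub>1 + P\<^sub>1) / (2 * s\<^sub>1)"
  shows "(\<lambda>n. real (f_count n) / real (g_count n)) \<longlonglongrightarrow> (s\<^sub>0 - P\<^sub>0) / (2 * s\<^sub>0)"
    and "(\<lambda>n. real (a_count n) / real (g_count n)) \<longlonglongrightarrow> \<eta>\<^sub>1 * (s\<^sub>1 - P\<^sub>1) / (2 * s\<^sub>1)"
    and "(\<lambda>n. real (b_count n) / real (g_count n)) \<longlonglongrightarrow> \<eta>\<^sub>2 * (s\<^sub>2 - P\<^sub>2) / (2 * s\<^sub>2)"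
    and "(\<lambda>n. real (t_count n) / real (g_count n)) \<longlonglongrightarrow> \<eta>\<^sub>2 * (s\<^sub>2 + P\<^sub>2) / (2 * s\<^sub>2)"
proof -
  let ?w = catalan_weight
  define F where "F n = real (f_count n) / 16 ^ n" for n
  define A where "A n = real (a_count n) / 16 ^ n" for n
  define B where "B n = real (b_count n) / 16 ^ n" for n
  define T where "T n = real (t_count n) / 16 ^ n" for n
  have w: "?w n = F n + A n + B n + T n" for n
    by (simp add: F_def A_def B_def T_def g_count_def add_divide_distrib flip: g_count_eq_catalan_weight)
  have nonneg: "0 \<le> F n" "0 \<le> A n" "0 \<le> B n" "0 \<le> T n" for n
    by (auto simp: F_def A_def B_def T_def)
  have F: "F n = (if n = 1 then 1 / 16 else 0) + (\<Sum>i\<le>n. (?w i - F i) * F (n - i))" for n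
    using scaled_convolution[where a = f_count and b = "\<lambda>i. a_count i + b_count i + t_count i" and c = f_count, OF f_count_rec[of n]]
    by (simp add: w F_def A_def B_def T_def add_divide_distrib add.assoc cong: if_cong)
  have A: "A n = (if n = 1 then 1 / 16 else 0) + (\<Sum>i\<le>n. (?w i - F i - A i) * A (n - i))" for n
    using scaled_convolution[where a = a_count and b = "\<lambda>i. b_count i + t_count i" and c = a_count, OF a_count_rec[of n]]
    by (simp add: w F_def A_def B_def T_def add_divide_distrib cong: if_cong)
  have B: "B n = (if n = 1 then 1 / 16 else 0) + (\<Sum>i\<le>n. (?w i - F i - A i - B i) * B (n - i))" for n
    using scaled_convolution[where a = b_count and b = t_count and c = b_count, OF b_count_rec[of n]]
    by (simp add: w F_def A_def B_def T_def add_divide_distrib cong: if_cong)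
  have s_pos: "0 < s\<^sub>0" "0 < s\<^sub>1" "0 < s\<^sub>2"
    by (auto simp: s0 s1 s2 intro: add_nonneg_pos)
  have P0_pos: "0 < P\<^sub>0" by (simp add: P0)
  have P1_pos: "0 < P\<^sub>1" using P0_pos s_pos by (simp add: P1)
  have P2_pos: "0 < P\<^sub>2" using P1_pos s_pos by (simp add: P2)
  have "\<forall>\<^sub>F n in sequentially. 1 = ?w n / ?w n"
    using catalan.pos by eventually_elim simp
  then have w_lim: "(\<lambda>n. ?w n / ?w n) \<longlonglongrightarrow> 1"
    by (rule Lim_transform_eventually[OF tendsto_const])
  note F_lim = catalan.quadratic_step[where h = ?w and a = F and r = "1 / 16",
      OF _ w_lim _ P0_pos _ _ F s0]
  have 1: "(\<lambda>n. F n / ?w n) \<longlonglongrightarrow> 1 * (s\<^sub>0 - P\<^sub>0) / (2 * s\<^sub>0)"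
    "(\<lambda>n. (?w n - F n) / ?w n) \<longlonglongrightarrow> 1 * (s\<^sub>0 + P\<^sub>0) / (2 * s\<^sub>0)"
    "1 - (\<Sum>n. ?w n - F n) = P\<^sub>1"
    using nonneg unfolding P1
    by (intro F_lim; auto simp: suminf_catalan_weight P0 w)+
  note A_lim = catalan.quadratic_step[where h = "\<lambda>n. ?w n - F n" and a = A and r = "1 / 16",
      OF _ 1(2,3) P1_pos _ _ A s1]
  have 2: "(\<lambda>n. A n / ?w n) \<longlonglongrightarrow> \<eta>\<^sub>1 * (s\<^sub>1 - P\<^sub>1) / (2 * s\<^sub>1)"
    "(\<lambda>n. (?w n - F n - A n) / ?w n) \<longlonglongrightarrow> \<eta>\<^sub>2"
    "1 - (\<Sum>n. ?w n - F n - A n) = P\<^sub>2"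
    using A_lim nonneg by (simp_all add: w \<eta>1 \<eta>2 P2)
  note B_lim = catalan.quadratic_step[where h = "\<lambda>n. ?w n - F n - A n" and a = B and r = "1 / 16",
      OF _ 2(2,3) P2_pos _ _ B s2]
  \<comment> \<open>After the third round what remains is \<open>T\<close> itself, so top gets its
    limit without a recurrence of its own.\<close>
  have 3: "(\<lambda>n. B n / ?w n) \<longlonglongrightarrow> \<eta>\<^sub>2 * (s\<^sub>2 - P\<^sub>2) / (2 * s\<^sub>2)"
    "(\<lambda>n. T n / ?w n) \<longlonglongrightarrow> \<eta>\<^sub>2 * (s\<^sub>2 + P\<^sub>2) / (2 * s\<^sub>2)"
    using B_lim nonneg by (simp_all add: w)
  have gw: "16 ^ n * ?w n = real (g_count n)" for n
    by (simp flip: g_count_eq_catalan_weight)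
  show "(\<lambda>n. real (f_count n) / real (g_count n)) \<longlonglongrightarrow> (s\<^sub>0 - P\<^sub>0) / (2 * s\<^sub>0)"
    and "(\<lambda>n. real (a_count n) / real (g_count n)) \<longlonglongrightarrow> \<eta>\<^sub>1 * (s\<^sub>1 - P\<^sub>1) / (2 * s\<^sub>1)"
    and "(\<lambda>n. real (b_count n) / real (g_count n)) \<longlonglongrightarrow> \<eta>\<^sub>2 * (s\<^sub>2 - P\<^sub>2) / (2 * s\<^sub>2)"
    and "(\<lambda>n. real (t_count n) / real (g_count n)) \<longlonglongrightarrow> \<eta>\<^sub>2 * (s\<^sub>2 + P\<^sub>2) / (2 * s\<^sub>2)"
    using 1(1) 2(1) 3 by (simp_all add: F_def A_def B_def T_def gw)
qed

section \<open>Numerical bounds and closed forms\<close>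

lemma p_top_bounds:
  fixes \<alpha> \<beta> \<gamma> :: real
  assumes beta: "\<beta> = sqrt (7 + 2 * sqrt 2)"
    and alpha: "\<alpha> = 1 + sqrt 2 + \<beta>"
    and gamma: "\<gamma> = sqrt (16 + \<alpha>\<^sup>2)"
  shows "0.684122210733017786 \<le> (2 + sqrt 2) * \<alpha> * (\<alpha> + \<gamma>) / (16 * \<beta> * \<gamma>)"
    and "(2 + sqrt 2) * \<alpha> * (\<alpha> + \<gamma>) / (16 * \<beta> * \<gamma>) < 0.684122210733017787"
proof -
  \<comment> \<open>Each quantity is enclosed to roughly 24 decimals, successively from
    \<open>sqrt 2\<close> to \<gamma>, which leaves room for 18 decimals of the quotient. Root
    bounds are checked by squaring.\<close>
  have s: "1.414213562373095048801688 \<le> sqrt 2" "sqrt 2 \<le> 1.414213562373095048801689"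
    by (intro real_le_rsqrt real_le_lsqrt; simp add: power2_eq_square)+
  have b: "3.135032236635883477594810 \<le> \<beta>" "\<beta> \<le> 3.135032236635883477594811"
    unfolding beta using s by (intro real_le_rsqrt real_le_lsqrt; simp add: power2_eq_square)+
  have a: "5.549245799008978526396498 \<le> \<alpha>" "\<alpha> \<le> 5.549245799008978526396500"
    unfolding alpha using s b by auto
  have a2: "5.549245799008978526396498\<^sup>2 \<le> \<alpha>\<^sup>2" "\<alpha>\<^sup>2 \<le> 5.549245799008978526396500\<^sup>2"
    using a by (auto intro!: power_mono)
  have g: "6.840623431955511209666895 \<le> \<gamma>" "\<gamma> \<le> 6.840623431955511209666897"
    unfolding gamma using a2 by (intro real_le_rsqrt real_le_lsqrt; simp add: power2_eq_square)+
  define N where "N = (2 + sqrt 2) * \<alpha> * (\<alpha> + \<gamma>)"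
  define D where "D = 16 * \<beta> * \<gamma>"
  have D: "16 * 3.135032236635883477594810 * 6.840623431955511209666895 \<le> D" "D \<le> 16 * 3.135032236635883477594811 * 6.840623431955511209666897"
    unfolding D_def using b g by (intro mult_mono; simp)+
  have N: "(2 + 1.414213562373095048801688) * 5.549245799008978526396498 * (5.549245799008978526396498 + 6.840623431955511209666895) \<le> N"
    "N \<le> (2 + 1.414213562373095048801689) * 5.549245799008978526396500 * (5.549245799008978526396500 + 6.840623431955511209666897)"
    unfolding N_def using s a g by (intro mult_mono add_mono; simp)+
  have D_pos: "0 < D" using b g by (simp add: D_def)
  have "0.684122210733017786 \<le> N / D" "N / D < 0.684122210733017787"
    using D N D_pos by (simp_all add: pos_le_divide_eq pos_divide_less_eq)
  then show "0.684122210733017786 \<le> (2 + sqrt 2) * \<alpha> * (\<alpha> + \<gamma>) / (16 * \<beta> * \<gamma>)"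
    and "(2 + sqrt 2) * \<alpha> * (\<alpha> + \<gamma>) / (16 * \<beta> * \<gamma>) < 0.684122210733017787"
    unfolding N_def D_def .
qed

theorem theorem2:
  fixes \<alpha> \<beta> \<gamma> :: real
  assumes beta: "\<beta> = sqrt (7 + 2 * sqrt 2)"
    and alpha: "\<alpha> = 1 + sqrt 2 + \<beta>"
    and gamma: "\<gamma> = sqrt (16 + \<alpha>\<^sup>2)"
  shows "\<exists>p_bot p_a p_b p_top :: real.
      (\<lambda>n. real (f_count n) / real (g_count n)) \<longlonglongrightarrow> p_bot \<and>
      (\<lambda>n. real (a_count n) / real (g_count n)) \<longlonglongrightarrow> p_a \<and>
      (\<lambda>n. real (b_count n) / real (g_count n)) \<longlonglongrightarrow> p_b \<and>
      (\<lambda>n. real (t_count n) / real (g_count n)) \<longlonglongrightarrow> p_top \<and>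
      p_bot + p_a + p_b + p_top = 1 \<and>
      p_bot = 1 / 2 - sqrt 2 / 4 \<and>
      p_a = (2 + sqrt 2) / (2 * \<alpha> * \<beta>) \<and>
      p_b = (2 + sqrt 2) * \<alpha> / (\<beta> * \<gamma> * (\<alpha> + \<gamma>)) \<and>
      p_top = (2 + sqrt 2) * \<alpha> * (\<alpha> + \<gamma>) / (16 * \<beta> * \<gamma>) \<and>
      0.684122210733017786 \<le> p_top \<and> p_top < 0.684122210733017787"
proof -
  define r :: real where "r = sqrt 2"
  have r: "r\<^sup>2 = 2" "0 < r" by (simp_all add: r_def)
  have b: "\<beta>\<^sup>2 = 7 + 2 * r" "0 < \<beta>" using r by (simp_all add: beta add_pos_pos flip: r_def)
  have a: "\<alpha> = 1 + r + \<beta>" "0 < \<alpha>" using r b by (simp_all add: alpha flip: r_def)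
  have g: "\<gamma>\<^sup>2 = 16 + \<alpha>\<^sup>2" "0 < \<gamma>" using a by (simp_all add: gamma add_pos_nonneg)
  \<comment> \<open>The parameters of \<open>count_limits\<close> are identified: the discriminant
    roots are \<open>r / 2\<close>, \<open>\<beta> / 4\<close> and \<open>\<gamma> / 8\<close>, and
    \<open>P\<close> runs through \<open>1 / 2\<close>, \<open>(1 + r) / 4\<close> and
    \<open>\<alpha> / 8\<close>.\<close>
  have s0: "r / 2 = sqrt ((1 / 2)\<^sup>2 + 4 * (1 / 16))"
    using r by (intro real_sqrt_unique[symmetric]) (simp_all add: power2_eq_square field_simps)
  have P1: "(1 + r) / 4 = (1 / 2 + r / 2) / 2" by simp
  have s1: "\<beta> / 4 = sqrt (((1 + r) / 4)\<^sup>2 + 4 * (1 / 16))"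
    using r b by (intro real_sqrt_unique[symmetric]) (simp_all add: power2_eq_square field_simps)
  have P2: "\<alpha> / 8 = ((1 + r) / 4 + \<beta> / 4) / 2" by (simp add: a)
  have s2: "\<gamma> / 8 = sqrt ((\<alpha> / 8)\<^sup>2 + 4 * (1 / 16))"
    using g by (intro real_sqrt_unique[symmetric]) (simp_all add: power2_eq_square field_simps)
  have \<eta>1: "(2 + r) / 4 = (r / 2 + 1 / 2) / (2 * (r / 2))"
    using r by (simp add: power2_eq_square field_simps)
  have \<eta>2: "(2 + r) * \<alpha> / (8 * \<beta>) = (2 + r) / 4 * (\<beta> / 4 + (1 + r) / 4) / (2 * (\<beta> / 4))"
    using b by (simp add: a field_simps)
  note lims = count_limits[OF refl s0 P1 s1 P2 s2 \<eta>1 \<eta>2]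
  have bot: "(r / 2 - 1 / 2) / (2 * (r / 2)) = 1 / 2 - r / 4"
    using r by (simp add: power2_eq_square field_simps)
  \<comment> \<open>A difference of squares moves \<open>s - P\<close> from the numerator to the
    denominator; the same is done below with \<gamma> and \<alpha>.\<close>
  have "\<alpha> * (\<beta> - (1 + r)) = 4"
    using r b by (simp add: a power2_eq_square algebra_simps)
  then have "(\<beta> - (1 + r)) = 4 / \<alpha>" using a by (simp add: field_simps)
  then have pa: "(2 + r) / 4 * (\<beta> / 4 - (1 + r) / 4) / (2 * (\<beta> / 4)) = (2 + r) / (2 * \<alpha> * \<beta>)"
    using a(2) b(2) by (simp add: diff_divide_distrib[symmetric]) (simp add: field_simps)
  define d where "d = \<alpha> + \<gamma>"
  have d: "0 < d" using a(2) g(2) by (simp add: d_def)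
  have "d * (\<gamma> - \<alpha>) = 16"
    using g by (simp add: d_def power2_eq_square algebra_simps)
  then have "\<gamma> - \<alpha> = 16 / d" using d by (simp add: field_simps)
  moreover have "\<gamma> / 8 - \<alpha> / 8 = (\<gamma> - \<alpha>) / 8" by simp
  ultimately have diff: "\<gamma> / 8 - \<alpha> / 8 = 2 / d" by simp
  have pb: "(2 + r) * \<alpha> / (8 * \<beta>) * (\<gamma> / 8 - \<alpha> / 8) / (2 * (\<gamma> / 8))
      = (2 + r) * \<alpha> / (\<beta> * \<gamma> * (\<alpha> + \<gamma>))"
    unfolding diff d_def[symmetric] using b(2) g(2) d by (simp add: field_simps)
  have top: "(2 + r) * \<alpha> / (8 * \<beta>) * (\<gamma> / 8 + \<alpha> / 8) / (2 * (\<gamma> / 8))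
      = (2 + r) * \<alpha> * (\<alpha> + \<gamma>) / (16 * \<beta> * \<gamma>)"
    using a(2) b(2) g(2)
    by (simp add: add_divide_distrib[symmetric] add.commute)
  note lims = lims[unfolded bot pa pb top]
  \<comment> \<open>That the limits add up to 1 is inherited from the four ratios, whose sum is 1
    once \<open>g_count n\<close> is positive; at \<open>n = 0\<close> division by zero would give
    0.\<close>
  have "\<forall>\<^sub>F n in sequentially. 1 = real (f_count n) / real (g_count n) + real (a_count n) / real (g_count n)
      + real (b_count n) / real (g_count n) + real (t_count n) / real (g_count n)"
    using catalan.pos
  proof eventually_elim
    case (elim n)
    then have "g_count n > 0" by (simp add: zero_less_divide_iff flip: g_count_eq_catalan_weight)
    moreover have "real (g_count n) = real (f_count n) + real (a_count n) + real (b_count n) + real (t_count n)"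
      by (simp add: g_count_def)
    ultimately show ?case by (simp flip: add_divide_distrib)
  qed
  then have "(\<lambda>n. real (f_count n) / real (g_count n) + real (a_count n) / real (g_count n)
      + real (b_count n) / real (g_count n) + real (t_count n) / real (g_count n)) \<longlonglongrightarrow> 1"
    by (rule Lim_transform_eventually[OF tendsto_const])
  from LIMSEQ_unique[OF tendsto_add[OF tendsto_add[OF tendsto_add[OF lims(1,2)] lims(3)] lims(4)] this]
  show ?thesis
    using lims p_top_bounds[OF beta alpha gamma] unfolding r_def by blast
qed

end
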